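(* Let $\mathcal{B}=(e_n)_{n=1}^\infty$ be a basis of an infinite-dimensional Banach space $\mathbb{X}$ over $\mathbb{K}=\mathbb{R}$ or $\mathbb{C}$. Then $\mathcal{B}$ is reverse partially greedy (RPG) if and only if there exists a constant $\mathbf{C}\geqslant 1$ such that $$\|x-P_{\Lambda}(x)\|\ \leqslant\ \mathbf{C}\,\check{\sigma}^{\Lambda}_m(x)\quad\text{for all } x\in\mathbb{X},\ m\in\mathbb{N},\ \Lambda\in G(x,m).$$
   Context: $\mathbb{N}=\{1,2,\ldots\}$. A basis of $\mathbb{X}$ is a sequence $\mathcal{B}=(e_n)_{n=1}^\infty$ in $\mathbb{X}$ such that: (i) the linear span of $(e_n)_n$ is norm-dense in $\mathbb{X}$; (ii) there are biorthogonal functionals $(e_n^* )_n\subset\mathbb{X}^*$, i.e. $e_n^*(e_m)=\delta_{n,m}$; (iii) there are $c_1,c_2>0$ with $c_1\leqslant\|e_n\|,\|e_n^*\|\leqslant c_2$ for all $n$. (Totality of $(e_n^* )_n$ and the Schauder property are not assumed.) For a finite set $A\subset\mathbb{N}$, $P_A(x)=\sum_{n\in A}e_n^*(x)e_n$. A finite set $\Lambda\subset\mathbb{N}$ is a greedy set of $x$ if $\min_{n\in\Lambda}|e_n^*(x)|\geqslant\max_{n\notin\Lambda}|e_n^*(x)|$; $G(x,m)$ is the set of all greedy sets of $x$ of cardinality $m$. For sets $A,B\subset\mathbb{N}$, $A>B$ means $a>b$ for all $a\in A$, $b\in B$ (vacuously true if one of them is empty), and similarly for $<,\geqslant,\leqslant$;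 a number $k$ is treated as $\{k\}$ in such comparisons. $\mathcal{B}$ is RPG if there is $\mathbf{C}\geqslant 1$ such that for all $x\in\mathbb{X}$, $m\in\mathbb{N}$, $\Lambda\in G(x,m)$, $$\|x-P_\Lambda(x)\|\leqslant\mathbf{C}\inf\{\|x-P_A(x)\|: A\subset\mathbb{N},\ |A|\leqslant m,\ A>\Lambda\}.$$ An interval is a set of consecutive positive integers. For $A\subset\mathbb{N}$, $$\check{\sigma}^{A}_m(x)=\inf\{\|x-P_I(x)\|:\ \text{either } I=\emptyset,\ \text{or } I \text{ is an interval with } A\leqslant\max I,\ |I|\leqslant m\}.$$ *)

theory Defs
  imports "HOL-Analysis.Analysis"
begin

text \<open>
  Banach spaces over \<open>\<real>\<close> and \<open>\<complex>\<close> are treated uniformly: by Gelfand-Mazur, a type of class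
  \<^class>\<open>real_normed_field\<close> is isometrically isomorphic to \<open>\<real>\<close> or to \<open>\<complex>\<close>.
  The class \<^class>\<open>banach\<close> supplies the norm, completeness and the real scalar
  multiplication, which \<open>smul\<close> extends.
\<close>

locale banach_space_over = vector_space smul
  for smul :: "'k::real_normed_field \<Rightarrow> 'a::banach \<Rightarrow> 'a" +
  assumes norm_smul: "norm (smul c x) = norm c * norm x"
    and smul_of_real: "smul (of_real r) x = r *\<^sub>R x"

lemma banach_space_over_scaleR: "banach_space_over (scaleR :: real \<Rightarrow> 'a::banach \<Rightarrow> 'a)"
  by unfold_locales (auto simp: algebra_simps)

lemma banach_space_over_complex: "banach_space_over ((*) :: complex \<Rightarrow> complex \<Rightarrow> complex)"
  by unfold_locales (auto simp: algebra_simps norm_mult scaleR_conv_of_real)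

definition infinite_dimensional :: "('k::field \<Rightarrow> 'a::ab_group_add \<Rightarrow> 'a) \<Rightarrow> bool" where
  "infinite_dimensional smul \<longleftrightarrow> (\<nexists>B. finite B \<and> module.span smul B = UNIV)"

definition dual_space :: "('k::real_normed_field \<Rightarrow> 'a::banach \<Rightarrow> 'a) \<Rightarrow> ('a \<Rightarrow> 'k) set" where
  "dual_space smul = {f. Vector_Spaces.linear smul (*) f \<and> bounded_linear f}"

text \<open>
  Sequences are indexed by \<^typ>\<open>nat\<close>, that is from 0 rather than from 1; only the order of the
  indices and the cardinalities of index sets matter below. The functionals
  \<open>es n\<close> (the \<open>e\<^sub>n\<^sup>*\<close>) are an explicit argument; density of the span and biorthogonality
  determine them uniquely. The norm of a functional is \<^const>\<open>onorm\<close>.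
\<close>

definition is_basis ::
  "('k::real_normed_field \<Rightarrow> 'a::banach \<Rightarrow> 'a) \<Rightarrow> (nat \<Rightarrow> 'a) \<Rightarrow> (nat \<Rightarrow> 'a \<Rightarrow> 'k) \<Rightarrow> bool" where
  "is_basis smul e es \<longleftrightarrow>
     closure (module.span smul (range e)) = UNIV \<and>
     (\<forall>n. es n \<in> dual_space smul) \<and>
     (\<forall>n m. es n (e m) = (if n = m then 1 else 0)) \<and>
     (\<exists>c1>0. \<exists>c2>0. \<forall>n. c1 \<le> norm (e n) \<and> norm (e n) \<le> c2 \<and>
                        c1 \<le> onorm (es n) \<and> onorm (es n) \<le> c2)"

definition proj ::
  "('k::real_normed_field \<Rightarrow> 'a::banach \<Rightarrow> 'a) \<Rightarrow> (nat \<Rightarrow> 'a) \<Rightarrow> (nat \<Rightarrow> 'a \<Rightarrow> 'k)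
    \<Rightarrow> nat set \<Rightarrow> 'a \<Rightarrow> 'a" where
  "proj smul e es A x = (\<Sum>n\<in>A. smul (es n x) (e n))"

definition greedy_sets ::
  "(nat \<Rightarrow> 'a::banach \<Rightarrow> 'k::real_normed_field) \<Rightarrow> 'a \<Rightarrow> nat \<Rightarrow> nat set set" where
  "greedy_sets es x m =
     {\<Lambda>. finite \<Lambda> \<and> card \<Lambda> = m \<and> (\<forall>n\<in>\<Lambda>. \<forall>k. k \<notin> \<Lambda> \<longrightarrow> norm (es n x) \<ge> norm (es k x))}"

definition RPG ::
  "('k::real_normed_field \<Rightarrow> 'a::banach \<Rightarrow> 'a) \<Rightarrow> (nat \<Rightarrow> 'a) \<Rightarrow> (nat \<Rightarrow> 'a \<Rightarrow> 'k) \<Rightarrow> bool" where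
  "RPG smul e es \<longleftrightarrow>
     (\<exists>C\<ge>1. \<forall>x. \<forall>m\<ge>1. \<forall>\<Lambda>\<in>greedy_sets es x m.
        norm (x - proj smul e es \<Lambda> x) \<le>
          C * Inf {norm (x - proj smul e es A x) | A.
                     finite A \<and> card A \<le> m \<and> (\<forall>a\<in>A. \<forall>b\<in>\<Lambda>. a > b)})"

definition nat_interval :: "nat set \<Rightarrow> bool" where
  "nat_interval I \<longleftrightarrow> (\<exists>a b. a \<le> b \<and> I = {a..b})"

definition sigma_check ::
  "('k::real_normed_field \<Rightarrow> 'a::banach \<Rightarrow> 'a) \<Rightarrow> (nat \<Rightarrow> 'a) \<Rightarrow> (nat \<Rightarrow> 'a \<Rightarrow> 'k)
    \<Rightarrow> nat set \<Rightarrow> nat \<Rightarrow> 'a \<Rightarrow> real" where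
  "sigma_check smul e es A m x =
     Inf {norm (x - proj smul e es I x) | I.
            I = {} \<or> (nat_interval I \<and> (\<forall>a\<in>A. a \<le> Max I) \<and> card I \<le> m)}"

end

theory Submission
  imports Defs
begin

text \<open>
  Both conditions say that removing a greedy set \<open>\<Lambda>\<close> from \<open>x\<close> is, up to a constant, at least as
  good as removing a competing set \<open>A\<close>; they differ in the admissible competitors. Since \<open>A = {}\<close>
  is always admissible, either condition makes the basis quasi-greedy:
  \<open>\<parallel>x - P\<^sub>\<Lambda> x\<parallel> \<le> C \<parallel>x\<parallel>\<close>.

  Given quasi-greediness, comparing \<open>\<Lambda>\<close> with \<open>A\<close> reduces to the single estimate
  \<open>\<parallel>P\<^sub>A\<^sub>-\<^sub>\<Lambda> x\<parallel> \<le> C \<parallel>P\<^sub>\<Lambda>\<^sub>-\<^sub>A x\<parallel>\<close> (lemma \<open>comparison_from_exchange\<close>). Indeed \<open>\<Lambda> - A\<close> is a greedy set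
  of \<open>y = x - P\<^sub>A x\<close>, so both \<open>y - P\<^sub>\<Lambda>\<^sub>-\<^sub>A y\<close> and \<open>P\<^sub>\<Lambda>\<^sub>-\<^sub>A y = P\<^sub>\<Lambda>\<^sub>-\<^sub>A x\<close> are controlled by \<open>\<parallel>y\<parallel>\<close>, and
  \<open>x - P\<^sub>\<Lambda> x = (y - P\<^sub>\<Lambda>\<^sub>-\<^sub>A y) + P\<^sub>A\<^sub>-\<^sub>\<Lambda> x\<close>.

  The estimate itself comes from applying the assumed condition to a finitely supported vector
  (lemma \<open>exchange_estimate\<close>). If the basis is RPG and \<open>A\<close> is an interval \<open>I\<close> with
  \<open>\<Lambda> \<le> max I\<close> and \<open>|I| \<le> |\<Lambda>|\<close>, then \<open>\<Lambda> - I\<close> lies to the left of \<open>I\<close> and has at least as many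
  elements as \<open>I - \<Lambda>\<close>, so RPG applies to the vector \<open>P\<^sub>\<Lambda>\<^sub>-\<^sub>I x + P\<^sub>I\<^sub>-\<^sub>\<Lambda> x\<close>.

  Conversely, let \<open>A > \<Lambda>\<close> with \<open>|A| \<le> |\<Lambda>|\<close>. The set \<open>A\<close> may have long gaps, so its hull
  \<open>H = [min A, max A]\<close> can be far too long to compete with \<open>\<Lambda>\<close>. The remedy is to fill the gaps:
  add large coefficients on \<open>H - A\<close> to \<open>P\<^sub>\<Lambda> x + P\<^sub>A x\<close>. Then \<open>\<Lambda> \<union> (H - A)\<close> is a greedy set with at
  least \<open>|H|\<close> elements. Removing it leaves \<open>P\<^sub>A x\<close>, removing \<open>H\<close> leaves \<open>P\<^sub>\<Lambda> x\<close>, and the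
  filling is cancelled on both sides.
\<close>

section \<open>Coordinate projections of a biorthogonal system\<close>

locale biorthogonal_system = vector_space smul
  for smul :: "'k::real_normed_field \<Rightarrow> 'a::banach \<Rightarrow> 'a" +
  fixes e :: "nat \<Rightarrow> 'a" and es :: "nat \<Rightarrow> 'a \<Rightarrow> 'k"
  assumes linear_es: "Vector_Spaces.linear smul (*) (es n)"
    and biorthogonal: "es n (e m) = (if n = m then 1 else 0)"
begin

abbreviation P :: "nat set \<Rightarrow> 'a \<Rightarrow> 'a" where
  "P \<equiv> proj smul e es"

abbreviation combination :: "nat set \<Rightarrow> (nat \<Rightarrow> 'k) \<Rightarrow> 'a" where
  "combination A c \<equiv> \<Sum>n\<in>A. smul (c n) (e n)"

lemma es_diff: "es n (x - y) = es n x - es n y"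
proof -
  interpret l: Vector_Spaces.linear smul "(*)" "es n" by (rule linear_es)
  show ?thesis by (rule l.diff)
qed

lemma es_combination:
  assumes "finite A"
  shows "es n (combination A c) = (if n \<in> A then c n else 0)"
proof -
  interpret l: Vector_Spaces.linear smul "(*)" "es n" by (rule linear_es)
  show ?thesis
    using assms by (simp add: l.sum l.scale biorthogonal if_distrib sum.delta cong: if_cong)
qed

lemma es_proj: "finite A \<Longrightarrow> es n (P A x) = (if n \<in> A then es n x else 0)"
  unfolding proj_def by (rule es_combination)

lemma proj_empty: "P {} x = 0"
  by (simp add: proj_def)

lemma proj_split: "finite A \<Longrightarrow> P A x = P (A \<inter> B) x + P (A - B) x"
  unfolding proj_def by (rule sum.Int_Diff)

lemma combination_minus_proj:
  assumes "finite F" "A \<subseteq> F"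
  shows "combination F c - P A (combination F c) = combination (F - A) c"
proof -
  have "P A (combination F c) = combination A c"
    unfolding proj_def using assms by (intro sum.cong) (auto simp: es_combination)
  then show ?thesis
    using assms by (simp add: sum_diff)
qed


section \<open>Comparison of greedy sets with competitors\<close>

text \<open>
  The relation \<open>R\<close> describes the admissible competitors of a greedy set. Each of the two
  conditions of the theorem is of this form once its infimum is resolved.
\<close>

definition greedy_bound :: "real \<Rightarrow> (nat set \<Rightarrow> nat set \<Rightarrow> bool) \<Rightarrow> bool" where
  "greedy_bound C R \<longleftrightarrow>
     (\<forall>x \<Lambda> A. \<Lambda> \<in> greedy_sets es x (card \<Lambda>) \<longrightarrow> R \<Lambda> A \<longrightarrow>
        norm (x - P \<Lambda> x) \<le> C * norm (x - P A x))"

text \<open>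
  The empty greedy set, which \<open>m \<ge> 1\<close> excludes on the left, satisfies the pointwise bound
  trivially because \<open>C \<ge> 1\<close> and its only competitor is the empty set.
\<close>

lemma bound_by_Inf_iff_greedy_bound:
  assumes "C \<ge> 1"
    and empty_competes: "\<And>m \<Lambda>. R m \<Lambda> {}"
    and only_empty: "\<And>A. R 0 {} A \<Longrightarrow> A = {}"
  shows "(\<forall>x. \<forall>m\<ge>1. \<forall>\<Lambda>\<in>greedy_sets es x m.
            norm (x - P \<Lambda> x) \<le> C * Inf {norm (x - P A x) | A. R m \<Lambda> A})
         \<longleftrightarrow> greedy_bound C (\<lambda>\<Lambda>. R (card \<Lambda>) \<Lambda>)" (is "?L \<longleftrightarrow> ?R")
proof -
  have Inf_iff: "v \<le> C * Inf {norm (x - P A x) | A. R m \<Lambda> A} \<longleftrightarrow>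
      (\<forall>A. R m \<Lambda> A \<longrightarrow> v \<le> C * norm (x - P A x))" for v x m \<Lambda>
  proof -
    let ?S = "{norm (x - P A x) | A. R m \<Lambda> A}"
    have "?S \<noteq> {}" using empty_competes by blast
    moreover have "bdd_below ?S" by (rule bdd_belowI[of _ 0]) auto
    ultimately have "v / C \<le> Inf ?S \<longleftrightarrow> (\<forall>s\<in>?S. v / C \<le> s)"
      by (rule le_cInf_iff)
    then show ?thesis
      using \<open>C \<ge> 1\<close> by (auto simp: pos_divide_le_eq mult.commute)
  qed
  show ?thesis
  proof
    assume L: ?L
    show ?R
      unfolding greedy_bound_def
    proof (intro allI impI)
      fix x \<Lambda> A
      assume greedy: "\<Lambda> \<in> greedy_sets es x (card \<Lambda>)" and R: "R (card \<Lambda>) \<Lambda> A"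
      show "norm (x - P \<Lambda> x) \<le> C * norm (x - P A x)"
      proof (cases "\<Lambda> = {}")
        case True
        then have "A = {}" using R only_empty by simp
        then show ?thesis
          using True \<open>C \<ge> 1\<close> mult_right_mono[of 1 C "norm (x - P A x)"] by simp
      next
        case False
        then have "card \<Lambda> \<ge> 1"
          using greedy by (simp add: greedy_sets_def Suc_le_eq card_gt_0_iff)
        then show ?thesis using L greedy R unfolding Inf_iff by blast
      qed
    qed
  next
    assume ?R
    moreover have "card \<Lambda> = m" if "\<Lambda> \<in> greedy_sets es x m" for \<Lambda> x m
      using that by (simp add: greedy_sets_def)
    ultimately show ?L
      unfolding Inf_iff greedy_bound_def by blast
  qed
qed

text \<open>
  The bound is applied to the vector with coefficients \<open>c\<close> on \<open>U \<union> V\<close>: its part on \<open>U \<inter> V\<close> is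
  removed together with \<open>U\<close> as well as with \<open>V\<close>, hence does not enter the estimate.
\<close>

lemma exchange_estimate:
  assumes bound: "greedy_bound C R" and "R U V" and fin: "finite U" "finite V"
    and larger: "\<And>n k. n \<in> U \<Longrightarrow> k \<in> V - U \<Longrightarrow> norm (c k) \<le> norm (c n)"
  shows "norm (combination (V - U) c) \<le> C * norm (combination (U - V) c)"
proof -
  let ?z = "combination (U \<union> V) c"
  have "U \<in> greedy_sets es ?z (card U)"
    using fin larger by (auto simp: greedy_sets_def es_combination)
  then have "norm (?z - P U ?z) \<le> C * norm (?z - P V ?z)"
    using bound \<open>R U V\<close> unfolding greedy_bound_def by blast
  moreover have "?z - P U ?z = combination (V - U) c"
    using fin combination_minus_proj[of "U \<union> V" U c] by (simp add: Un_Diff)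
  moreover have "?z - P V ?z = combination (U - V) c"
    using fin combination_minus_proj[of "U \<union> V" V c] by (simp add: Un_Diff)
  ultimately show ?thesis by simp
qed

text \<open>
  Removing \<open>A\<close> from \<open>x\<close> annihilates the coefficients on \<open>A\<close> and keeps the others, so \<open>\<Lambda> - A\<close> stays
  greedy for \<open>y = x - P\<^sub>A x\<close>. Quasi-greediness at \<open>y\<close> bounds what is left of \<open>y\<close> and, by the
  triangle inequality, also \<open>P\<^sub>\<Lambda>\<^sub>-\<^sub>A x\<close>.
\<close>

lemma comparison_from_exchange:
  assumes quasi_greedy: "greedy_bound C (\<lambda>\<Lambda> A. A = {})"
    and greedy: "\<Lambda> \<in> greedy_sets es x (card \<Lambda>)" and "finite A" and "C \<ge> 1"
    and exchange: "norm (P (A - \<Lambda>) x) \<le> C * norm (P (\<Lambda> - A) x)"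
  shows "norm (x - P \<Lambda> x) \<le> (C + C * (1 + C)) * norm (x - P A x)"
proof -
  define y where "y = x - P A x"
  have "finite \<Lambda>" using greedy by (simp add: greedy_sets_def)
  have es_y: "es n y = (if n \<in> A then 0 else es n x)" for n
    using \<open>finite A\<close> by (simp add: y_def es_diff es_proj)
  have "\<Lambda> - A \<in> greedy_sets es y (card (\<Lambda> - A))"
    using greedy by (auto simp: greedy_sets_def es_y)
  then have "norm (y - P (\<Lambda> - A) y) \<le> C * norm (y - P {} y)"
    using quasi_greedy unfolding greedy_bound_def by blast
  moreover have Py: "P (\<Lambda> - A) y = P (\<Lambda> - A) x"
    unfolding proj_def by (rule sum.cong) (auto simp: es_y)
  ultimately have rest: "norm (y - P (\<Lambda> - A) x) \<le> C * norm y"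
    by (simp add: proj_empty)
  then have "norm (P (\<Lambda> - A) x) \<le> (1 + C) * norm y"
    using norm_triangle_ineq4[of y "y - P (\<Lambda> - A) x"] by (simp add: algebra_simps)
  then have "C * norm (P (\<Lambda> - A) x) \<le> C * ((1 + C) * norm y)"
    using \<open>C \<ge> 1\<close> by (intro mult_left_mono) auto
  moreover have "x - P \<Lambda> x = (y - P (\<Lambda> - A) x) + P (A - \<Lambda>) x"
    using proj_split[OF \<open>finite \<Lambda>\<close>, of x A] proj_split[OF \<open>finite A\<close>, of x \<Lambda>]
    by (simp add: y_def Int_commute)
  ultimately have "norm (x - P \<Lambda> x) \<le> C * norm y + C * ((1 + C) * norm y)"
    using rest exchange norm_triangle_ineq[of "y - P (\<Lambda> - A) x" "P (A - \<Lambda>) x"] by simp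
  then show ?thesis by (simp add: y_def algebra_simps)
qed

lemma greedy_bound_transfer:
  assumes bound: "greedy_bound C R" and "C \<ge> 1" and empty_competes: "\<And>\<Lambda>. R \<Lambda> {}"
    and finite_competitor: "\<And>\<Lambda> A. R' \<Lambda> A \<Longrightarrow> finite A"
    and exchange: "\<And>x \<Lambda> A. \<Lambda> \<in> greedy_sets es x (card \<Lambda>) \<Longrightarrow> R' \<Lambda> A \<Longrightarrow>
      norm (P (A - \<Lambda>) x) \<le> C * norm (P (\<Lambda> - A) x)"
  shows "greedy_bound (C + C * (1 + C)) R'"
proof -
  have "greedy_bound C (\<lambda>\<Lambda> A. A = {})"
    using bound empty_competes unfolding greedy_bound_def by blast
  from comparison_from_exchange[OF this _ finite_competitor \<open>C \<ge> 1\<close> exchange]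
  show ?thesis
    unfolding greedy_bound_def by simp
qed


section \<open>Competitors to the right and interval competitors\<close>

definition right_competitor :: "nat \<Rightarrow> nat set \<Rightarrow> nat set \<Rightarrow> bool" where
  "right_competitor m \<Lambda> A \<longleftrightarrow> finite A \<and> card A \<le> m \<and> (\<forall>a\<in>A. \<forall>b\<in>\<Lambda>. a > b)"

definition interval_competitor :: "nat \<Rightarrow> nat set \<Rightarrow> nat set \<Rightarrow> bool" where
  "interval_competitor m \<Lambda> I \<longleftrightarrow>
     I = {} \<or> (nat_interval I \<and> (\<forall>a\<in>\<Lambda>. a \<le> Max I) \<and> card I \<le> m)"

lemma Max_nat_interval: "l \<le> r \<Longrightarrow> Max {l..r} = r" for l r :: nat
  by (rule Max_eqI) auto

text \<open>
  The common part \<open>\<Lambda> \<inter> I\<close> drops out of the exchange estimate; what remains of \<open>\<Lambda>\<close> lies entirely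
  to the left of what remains of \<open>I\<close>, whose size is no larger, which is the situation of RPG.
\<close>

lemma interval_bound_from_right_bound:
  assumes bound: "greedy_bound C (\<lambda>\<Lambda>. right_competitor (card \<Lambda>) \<Lambda>)" and "C \<ge> 1"
  shows "greedy_bound (C + C * (1 + C)) (\<lambda>\<Lambda>. interval_competitor (card \<Lambda>) \<Lambda>)"
proof (rule greedy_bound_transfer[OF bound \<open>C \<ge> 1\<close>])
  show "right_competitor (card \<Lambda>) \<Lambda> {}" for \<Lambda>
    by (simp add: right_competitor_def)
  show finite_I: "finite I" if "interval_competitor (card \<Lambda>) \<Lambda> I" for \<Lambda> I
    using that by (auto simp: interval_competitor_def nat_interval_def)
  fix x \<Lambda> I
  assume greedy: "\<Lambda> \<in> greedy_sets es x (card \<Lambda>)"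
    and I: "interval_competitor (card \<Lambda>) \<Lambda> I"
  have "finite \<Lambda>" "finite I"
    using greedy finite_I[OF I] by (auto simp: greedy_sets_def)
  have "right_competitor (card (\<Lambda> - I)) (\<Lambda> - I) (I - \<Lambda>)"
    unfolding right_competitor_def
  proof (intro conjI ballI)
    show "finite (I - \<Lambda>)" using \<open>finite I\<close> by simp
    have "card I \<le> card \<Lambda>" using I by (auto simp: interval_competitor_def)
    then show "card (I - \<Lambda>) \<le> card (\<Lambda> - I)"
      using card_Int_Diff[OF \<open>finite I\<close>, of \<Lambda>] card_Int_Diff[OF \<open>finite \<Lambda>\<close>, of I]
      by (simp add: Int_commute)
    fix a b assume a: "a \<in> I - \<Lambda>" and b: "b \<in> \<Lambda> - I"
    then obtain l r where "l \<le> r" "I = {l..r}"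
      using I by (auto simp: interval_competitor_def nat_interval_def)
    \<comment> \<open>An element of \<open>\<Lambda>\<close> cannot exceed the right end of \<open>I\<close>, so outside \<open>I\<close> it is left of \<open>I\<close>.\<close>
    moreover from this have "b \<le> r"
      using I b by (auto simp: interval_competitor_def Max_nat_interval)
    ultimately show "b < a" using a b by auto
  qed
  then have "norm (combination ((I - \<Lambda>) - (\<Lambda> - I)) (\<lambda>n. es n x))
      \<le> C * norm (combination ((\<Lambda> - I) - (I - \<Lambda>)) (\<lambda>n. es n x))"
    using greedy \<open>finite \<Lambda>\<close> \<open>finite I\<close>
    by (intro exchange_estimate[OF bound]) (auto simp: greedy_sets_def)
  moreover have "(I - \<Lambda>) - (\<Lambda> - I) = I - \<Lambda>" "(\<Lambda> - I) - (I - \<Lambda>) = \<Lambda> - I" by auto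
  ultimately show "norm (P (I - \<Lambda>) x) \<le> C * norm (P (\<Lambda> - I) x)"
    by (simp add: proj_def)
qed

text \<open>
  The hull \<open>H\<close> of \<open>A\<close> becomes short enough once the gaps \<open>H - A\<close> are counted as part of the greedy
  set, because \<open>|H| = |A| + |H - A| \<le> |\<Lambda>| + |H - A|\<close>.
\<close>

lemma right_bound_from_interval_bound:
  assumes bound: "greedy_bound C (\<lambda>\<Lambda>. interval_competitor (card \<Lambda>) \<Lambda>)" and "C \<ge> 1"
  shows "greedy_bound (C + C * (1 + C)) (\<lambda>\<Lambda>. right_competitor (card \<Lambda>) \<Lambda>)"
proof (rule greedy_bound_transfer[OF bound \<open>C \<ge> 1\<close>])
  show "interval_competitor (card \<Lambda>) \<Lambda> {}" for \<Lambda>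
    by (simp add: interval_competitor_def)
  show "finite A" if "right_competitor (card \<Lambda>) \<Lambda> A" for \<Lambda> A
    using that by (simp add: right_competitor_def)
  fix x \<Lambda> A
  assume greedy: "\<Lambda> \<in> greedy_sets es x (card \<Lambda>)"
    and A: "right_competitor (card \<Lambda>) \<Lambda> A"
  have "finite \<Lambda>" using greedy by (simp add: greedy_sets_def)
  have "finite A" and card_A: "card A \<le> card \<Lambda>" and right: "\<And>a b. a \<in> A \<Longrightarrow> b \<in> \<Lambda> \<Longrightarrow> b < a"
    using A by (auto simp: right_competitor_def)
  show "norm (P (A - \<Lambda>) x) \<le> C * norm (P (\<Lambda> - A) x)"
  proof (cases "A = {}")
    case True
    then show ?thesis using \<open>C \<ge> 1\<close> by (simp add: proj_empty)
  next
    case False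
    define H where "H = {Min A..Max A}"
    define U where "U = \<Lambda> \<union> (H - A)"
    \<comment> \<open>The height of the filling only has to dominate every coefficient of \<open>x\<close> on \<open>A\<close>.\<close>
    define s where "s = (\<Sum>k\<in>A. norm (es k x))"
    define c where "c n = (if n \<in> H - A then of_real s else es n x)" for n
    have "finite H" by (simp add: H_def)
    have "A \<subseteq> H" using \<open>finite A\<close> by (auto simp: H_def)
    have "Min A \<le> Max A" using \<open>finite A\<close> False by simp
    have below_H: "b < h" if "b \<in> \<Lambda>" "h \<in> H" for b h
      using right[OF Min_in[OF \<open>finite A\<close> False] \<open>b \<in> \<Lambda>\<close>] \<open>h \<in> H\<close> by (simp add: H_def)
    have V_U: "H - U = A" using \<open>A \<subseteq> H\<close> below_H by (auto simp: U_def)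
    have U_V: "U - H = \<Lambda>" using below_H by (auto simp: U_def)
    have "interval_competitor (card U) U H"
      unfolding interval_competitor_def nat_interval_def
    proof (intro disjI2 conjI ballI)
      show "\<exists>a b. a \<le> b \<and> H = {a..b}" using \<open>Min A \<le> Max A\<close> H_def by blast
      have "Max H = Max A" 
        unfolding H_def using \<open>Min A \<le> Max A\<close> by (rule Max_nat_interval)
      moreover have "Max A \<in> H" using \<open>Min A \<le> Max A\<close> by (simp add: H_def)
      ultimately show "b \<le> Max H" if "b \<in> U" for b
        using that below_H[of b "Max A"] by (auto simp: U_def H_def)
      have "card U = card \<Lambda> + card (H - A)"
        unfolding U_def using \<open>finite \<Lambda>\<close> \<open>finite H\<close> below_H by (intro card_Un_disjoint) auto
      moreover have "card H = card A + card (H - A)"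
        using card_Int_Diff[OF \<open>finite H\<close>, of A] \<open>A \<subseteq> H\<close> by (simp add: Int_absorb1)
      ultimately show "card H \<le> card U" using card_A by simp
    qed
    moreover have "norm (c k) \<le> norm (c n)" if "n \<in> U" "k \<in> H - U" for n k
    proof -
      have "k \<in> A" using that(2) V_U by simp
      then have c_k: "c k = es k x" by (simp add: c_def)
      show ?thesis
      proof (cases "n \<in> H - A")
        case True
        have "norm (es k x) \<le> s"
          unfolding s_def using \<open>finite A\<close> \<open>k \<in> A\<close> by (intro member_le_sum) auto
        then show ?thesis using True c_k by (simp add: c_def)
      next
        case False
        then have "n \<in> \<Lambda>" using \<open>n \<in> U\<close> by (auto simp: U_def)
        moreover have "k \<notin> \<Lambda>" using right \<open>k \<in> A\<close> by blast
        ultimately show ?thesis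
          using greedy c_k False by (auto simp: greedy_sets_def c_def)
      qed
    qed
    ultimately have "norm (combination (H - U) c) \<le> C * norm (combination (U - H) c)"
      using \<open>finite \<Lambda>\<close> \<open>finite H\<close> by (intro exchange_estimate[OF bound]) (auto simp: U_def)
    moreover have "combination A c = P A x"
      unfolding proj_def by (rule sum.cong) (auto simp: c_def)
    moreover have "combination \<Lambda> c = P \<Lambda> x"
      unfolding proj_def using below_H by (intro sum.cong) (auto simp: c_def)
    moreover have "A - \<Lambda> = A" "\<Lambda> - A = \<Lambda>" using right by auto
    ultimately show ?thesis by (simp add: V_U U_V)
  qed
qed

end

theorem theorem1p1:
  fixes smul :: "'k::real_normed_field \<Rightarrow> 'a::banach \<Rightarrow> 'a"
    and e :: "nat \<Rightarrow> 'a" and es :: "nat \<Rightarrow> 'a \<Rightarrow> 'k"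
  assumes "banach_space_over smul"
    and "infinite_dimensional smul"
    and "is_basis smul e es"
  shows "RPG smul e es \<longleftrightarrow>
    (\<exists>C\<ge>1. \<forall>x. \<forall>m\<ge>1. \<forall>\<Lambda>\<in>greedy_sets es x m.
       norm (x - proj smul e es \<Lambda> x) \<le> C * sigma_check smul e es \<Lambda> m x)"
proof -
  interpret banach_space_over smul by fact
  interpret biorthogonal_system smul e es
    using \<open>is_basis smul e es\<close> vector_space_axioms
    by (intro biorthogonal_system.intro biorthogonal_system_axioms.intro)
      (auto simp: is_basis_def dual_space_def)
  have RPG_iff: "RPG smul e es \<longleftrightarrow>
      (\<exists>C\<ge>1. greedy_bound C (\<lambda>\<Lambda>. right_competitor (card \<Lambda>) \<Lambda>))"
    unfolding RPG_def right_competitor_def[symmetric]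
    by (intro ex_cong1 conj_cong refl bound_by_Inf_iff_greedy_bound)
      (auto simp: right_competitor_def)
  have interval_iff: "(\<exists>C\<ge>1. \<forall>x. \<forall>m\<ge>1. \<forall>\<Lambda>\<in>greedy_sets es x m.
        norm (x - P \<Lambda> x) \<le> C * sigma_check smul e es \<Lambda> m x) \<longleftrightarrow>
      (\<exists>C\<ge>1. greedy_bound C (\<lambda>\<Lambda>. interval_competitor (card \<Lambda>) \<Lambda>))"
    unfolding sigma_check_def interval_competitor_def[symmetric]
    by (intro ex_cong1 conj_cong refl bound_by_Inf_iff_greedy_bound)
      (auto simp: interval_competitor_def nat_interval_def)
  have "C + C * (1 + C) \<ge> 1" if "C \<ge> 1" for C :: real
    using that by (simp add: add_increasing2)
  then show ?thesis
    unfolding RPG_iff interval_iff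
    using interval_bound_from_right_bound right_bound_from_interval_bound by blast
qed

end
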